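(* Let $k,n$ be positive integers with $n\ge \frac{(k+4)(k-1)}{2}+1$. Then there exists a ucycle of the set of all onto functions $f:[n]\to[k]$ for which the preimage cardinality function is non-decreasing, i.e. $|f^{-1}(\{1\})|\le|f^{-1}(\{2\})|\le\cdots\le|f^{-1}(\{k\})|$.
   Context: $[m]=\{1,2,\dots,m\}$. A function $f:[n]\to[k]$ is identified with the string $f(1)f(2)\cdots f(n)$ of length $n$ over the alphabet $[k]$. A ucycle (universal cycle) of a finite nonempty set $\mathcal F$ of strings of length $n$ over $[k]$ is a cyclic sequence $a_1a_2\cdots a_N$ of elements of $[k]$, with $N=|\mathcal F|$ and indices taken modulo $N$, such that the $N$ windows $a_ia_{i+1}\cdots a_{i+n-1}$ ($1\le i\le N$) are exactly the elements of $\mathcal F$, each occurring exactly once. *)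

theory Defs
  imports Complex_Main "HOL-Library.FuncSet"
begin

definition onto_functions :: "nat \<Rightarrow> nat \<Rightarrow> (nat \<Rightarrow> nat) set" where
  "onto_functions n k = {f \<in> {1..n} \<rightarrow>\<^sub>E {1..k}. f ` {1..n} = {1..k}}"

definition preimage_card :: "nat \<Rightarrow> (nat \<Rightarrow> nat) \<Rightarrow> nat \<Rightarrow> nat" where
  "preimage_card n f i = card {j \<in> {1..n}. f j = i}"

text \<open>On extensional functions on \<open>{1..n}\<close> the following map is injective, so it
  identifies a function with the string of its values.\<close>

definition string_of_fun :: "nat \<Rightarrow> (nat \<Rightarrow> nat) \<Rightarrow> nat list" where
  "string_of_fun n f = map f [1..<Suc n]"

text \<open>Positions in a cyclic sequence are counted from 0, modulo its length; a window may
  be longer than the sequence and then wraps around it several times.\<close>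

definition window :: "nat \<Rightarrow> 'a list \<Rightarrow> nat \<Rightarrow> 'a list" where
  "window n a i = map (\<lambda>j. a ! ((i + j) mod length a)) [0..<n]"

definition is_ucycle :: "nat \<Rightarrow> nat \<Rightarrow> nat list set \<Rightarrow> nat list \<Rightarrow> bool" where
  "is_ucycle n k F a \<longleftrightarrow>
     finite F \<and> F \<noteq> {} \<and> F \<subseteq> {w. length w = n \<and> set w \<subseteq> {1..k}} \<and>
     set a \<subseteq> {1..k} \<and> length a = card F \<and>
     bij_betw (window n a) {..<card F} F"

end

theory Submission
  imports Defs "Graph_Theory.Euler"
begin

text \<open>
  If a set of words is closed under permuting letters, then its transition digraph (words as
  arcs from their prefix to their suffix) is balanced, so by Euler's theorem it only has to be
  connected; rotations of a word lie on a closed walk, so it is enough that any two words are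
  joined by changing one letter at a time inside the set.  For non-decreasing letter counts,
  one can move the counts greedily towards any fixed non-decreasing vector of positive counts.
  We aim at \<open>(2, 3, \<dots>, k, r)\<close> with \<open>r \<ge> k\<close>, for which the bound on \<open>n\<close> leaves exactly enough
  room: there any letter \<open>x < k\<close> may be turned into \<open>k\<close>, so any two positions can be swapped.
\<close>

section \<open>Universal cycles from connectivity under letter changes\<close>

definition letter_change :: "'a list set \<Rightarrow> 'a list \<Rightarrow> 'a list \<Rightarrow> bool" where
  "letter_change F w w' \<longleftrightarrow> w \<in> F \<and> w' \<in> F \<and> (\<exists>p<length w. \<exists>y. w' = w[p := y])"

lemma letter_change_sym: "letter_change F w w' \<Longrightarrow> letter_change F w' w"
  unfolding letter_change_def
  by (metis length_list_update list_update_id list_update_overwrite)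

lemma letter_changes_sym: "(letter_change F)\<^sup>*\<^sup>* w w' \<Longrightarrow> (letter_change F)\<^sup>*\<^sup>* w' w"
  by (metis letter_change_sym sympI symp_rtranclp sympD)

section \<open>Closed walks and the windows of a cyclic sequence\<close>

lemma cas_head_nth:
  assumes "pre_digraph.cas G u p v" "i < length p"
  shows "head G (p ! i) = (if Suc i < length p then tail G (p ! Suc i) else v)"
  using assms
proof (induction p arbitrary: u i)
  case Nil
  then show ?case by simp
next
  case (Cons e p)
  have c: "pre_digraph.cas G (head G e) p v"
    using Cons.prems(1) by (simp add: pre_digraph.cas.simps)
  show ?case
  proof (cases i)
    case 0
    with c show ?thesis by (cases p) (auto simp: pre_digraph.cas.simps)
  next
    case (Suc j)
    with Cons.IH[OF c, of j] Cons.prems(2) show ?thesis by simp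
  qed
qed

text \<open>The last arc ends at \<open>u\<close>, where arc 0 starts; this is the wrap-around in
  \<open>Suc i mod length p\<close>.\<close>

lemma closed_cas_head_nth:
  assumes "pre_digraph.cas G u p u" "i < length p"
  shows "head G (p ! i) = tail G (p ! (Suc i mod length p))"
proof -
  have "u = tail G (p ! 0)"
    using assms by (cases p) (auto simp: pre_digraph.cas.simps)
  moreover have "length p = Suc i" if "\<not> Suc i < length p"
    using that assms(2) by simp
  ultimately show ?thesis
    using cas_head_nth[OF assms] by (auto split: if_splits)
qed

text \<open>Consecutive words overlap in all but one letter, so letter \<open>Suc j\<close> of a
  word is letter \<open>j\<close> of the next one. After \<open>j\<close> steps letter
  \<open>j\<close> of word \<open>i\<close> has become the first letter of word
  \<open>i + j\<close>. The indices are cyclic throughout, so \<open>n\<close> may exceed the length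
  of \<open>p\<close>.\<close>

lemma window_map_hd:
  assumes len: "\<And>w. w \<in> set p \<Longrightarrow> length w = n" and "n > 0"
    and cyc: "\<And>i. i < length p \<Longrightarrow> tl (p ! i) = butlast (p ! (Suc i mod length p))"
    and i: "i < length p"
  shows "window n (map hd p) i = p ! i"
proof -
  let ?N = "length p"
  have N: "?N > 0" using i by linarith
  have *: "p ! i ! j = hd (p ! ((i + j) mod ?N))" if "j < n" "i < ?N" for i j
    using that
  proof (induction j arbitrary: i)
    case 0
    then have "p ! i \<noteq> []" using len[of "p ! i"] by auto
    with 0 show ?case by (simp add: hd_conv_nth)
  next
    case (Suc j)
    let ?i = "Suc i mod ?N"
    have i': "?i < ?N" using N by simp
    have l: "length (p ! i) = n" "length (p ! ?i) = n"
      using len Suc.prems i' nth_mem by blast+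
    have "p ! i ! Suc j = tl (p ! i) ! j" using l Suc.prems by (simp add: nth_tl)
    also have "\<dots> = p ! ?i ! j" using cyc[OF Suc.prems(2)] Suc.prems(1) l by (simp add: nth_butlast)
    also have "\<dots> = hd (p ! ((?i + j) mod ?N))" using Suc.IH i' Suc.prems by simp
    also have "(?i + j) mod ?N = (i + Suc j) mod ?N" by (simp add: mod_simps)
    finally show ?case .
  qed
  have "length (p ! i) = n" using len i by simp
  then show ?thesis
    unfolding window_def using * i N by (intro nth_equalityI) auto
qed

text \<open>An Euler circuit passes each word of \<open>F\<close> exactly once as an arc, and
  successive arcs overlap as \<open>window_map_hd\<close> demands, so the first letters of its arcs
  spell the cycle.\<close>

lemma ucycle_if_letter_changes_connected:
  fixes F :: "nat list set"
  assumes fin: "finite F" and ne: "F \<noteq> {}" and n: "n > 0"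
    and len: "\<And>w. w \<in> F \<Longrightarrow> length w = n"
    and sub: "\<And>w. w \<in> F \<Longrightarrow> set w \<subseteq> {1..k}"
    and perm: "\<And>w w'. w \<in> F \<Longrightarrow> mset w' = mset w \<Longrightarrow> w' \<in> F"
    and conn: "\<And>w w'. w \<in> F \<Longrightarrow> w' \<in> F \<Longrightarrow> (letter_change F)\<^sup>*\<^sup>* w w'"
  shows "\<exists>a. is_ucycle n k F a"
proof -
  define G where "G = \<lparr>verts = butlast ` F, arcs = F, tail = butlast, head = tl\<rparr>"
  have G [simp]: "verts G = butlast ` F" "arcs G = F" "tail G = butlast" "head G = tl"
    by (simp_all add: G_def)
  have nonempty: "w \<noteq> []" if "w \<in> F" for w using len[OF that] n by auto
  have rot: "rotate m w \<in> F" if "w \<in> F" for m w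
    using that
  proof (rule perm)
    have "mset (rotate1 u) = mset u" for u :: "nat list" by (cases u) auto
    then show "mset (rotate m w) = mset w" by (induction m) simp_all
  qed
  have tl_rot: "tl w = butlast (rotate1 w)" for w :: "nat list"
    by (cases w) auto
  \<comment> \<open>The vertices are only the prefixes of words. A suffix is one too: it is the
    prefix of the rotated word, which lies in \<open>F\<close>.\<close>
  interpret fin_digraph G
    by unfold_locales (use fin rot[of _ 1] in \<open>auto simp: tl_rot\<close>)
  have adj: "butlast w \<rightarrow>\<^bsub>G\<^esub> butlast (rotate1 w)" if "w \<in> F" for w
    using that by (auto simp: arcs_ends_conv tl_rot)
  have reach_rot: "butlast w \<rightarrow>\<^sup>*\<^bsub>G\<^esub> butlast (rotate m w)" if "w \<in> F" for m w
  proof (induction m)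
    case 0
    then show ?case using that by simp
  next
    case (Suc m)
    also have "butlast (rotate m w) \<rightarrow>\<^bsub>G\<^esub> butlast (rotate (Suc m) w)"
      using adj[OF rot[OF that]] by simp
    finally show ?case .
  qed
  have reach_step: "butlast w \<rightarrow>\<^sup>*\<^bsub>G\<^esub> butlast w'" if "letter_change F w w'" for w w'
  proof -
    from that obtain p y where w: "w \<in> F" "w' \<in> F" "p < length w" "w' = w[p := y]"
      unfolding letter_change_def by blast
    \<comment> \<open>Write \<open>w\<close> as u x v and \<open>w'\<close> as u y v. Rotating
      \<open>w\<close> to v u x puts the changing letter last, so the prefix v u no longer sees it.
      That vertex is also the prefix of v u y, which rotates on to \<open>w'\<close>.\<close>
    define u v where "u = take p w" and "v = drop (Suc p) w"
    have e: "w = (u @ [w ! p]) @ v" "w' = u @ y # v"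
      using w by (simp_all add: u_def v_def id_take_nth_drop[symmetric] upd_conv_take_nth_drop)
    have "butlast (rotate (length (u @ [w ! p])) w) = v @ u"
      by (subst e(1), subst rotate_append) (simp add: butlast_append)
    then have "butlast w \<rightarrow>\<^sup>*\<^bsub>G\<^esub> (v @ u)"
      using reach_rot[OF w(1)] by metis
    also have "v @ u = butlast (v @ u @ [y])" by (simp add: butlast_append)
    also have "\<dots> \<rightarrow>\<^sup>*\<^bsub>G\<^esub> butlast (rotate (length v) (v @ u @ [y]))"
      by (rule reach_rot, rule perm[OF w(2)]) (simp add: e(2))
    also have "rotate (length v) (v @ u @ [y]) = w'"
      by (simp add: rotate_append e(2))
    finally show ?thesis .
  qed
  have reach: "butlast w \<rightarrow>\<^sup>*\<^bsub>G\<^esub> butlast w'" if "w \<in> F" "w' \<in> F" for w w'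
    using conn[OF that]
  proof (induction rule: rtranclp_induct)
    case base
    then show ?case using that by simp
  next
    case (step y z)
    then show ?case using reach_step reachable_trans by blast
  qed
  have "Digraph_Component.connected G"
    using ne reach by (intro connectedI) (auto intro: reachable_mk_symmetricI)
  moreover have "in_degree G v = out_degree G v" for v
  proof -
    \<comment> \<open>Balance: moving the first letter to the end turns a word with suffix
      \<open>v\<close> into a word with prefix \<open>v\<close>, and this can be undone.\<close>
    have "bij_betw rotate1 (in_arcs G v) (out_arcs G v)"
    proof (rule bij_betwI[where g = "\<lambda>w. last w # butlast w"])
      show "rotate1 \<in> in_arcs G v \<rightarrow> out_arcs G v"
        using rot[of _ 1] by (auto simp: in_arcs_def out_arcs_def tl_rot)
      show "(\<lambda>w. last w # butlast w) \<in> out_arcs G v \<rightarrow> in_arcs G v"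
      proof
        fix w assume w: "w \<in> out_arcs G v"
        then have "mset (last w # butlast w) = mset w"
          using nonempty by (cases w rule: rev_cases) (auto simp: out_arcs_def)
        then show "last w # butlast w \<in> in_arcs G v"
          using w perm by (auto simp: in_arcs_def out_arcs_def)
      qed
      show "last (rotate1 w) # butlast (rotate1 w) = w" if "w \<in> in_arcs G v" for w
        using that nonempty by (cases w) (auto simp: in_arcs_def)
      show "rotate1 (last w # butlast w) = w" if "w \<in> out_arcs G v" for w
        using that nonempty by (auto simp: out_arcs_def)
    qed
    then show ?thesis
      unfolding in_degree_def out_degree_def by (rule bij_betw_same_card)
  qed
  ultimately obtain u p where et: "euler_trail u p u"
    using closed_euler1 by blast
  then have p: "distinct p" "set p = F" "cas u p u"
    by (auto simp: euler_trail_def trail_def awalk_def)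
  have N: "length p = card F" using p distinct_card by fastforce
  have "window n (map hd p) i = p ! i" if "i < length p" for i
    using window_map_hd[of p n i] closed_cas_head_nth[OF p(3)] len n p(2) that by simp
  moreover have "bij_betw ((!) p) {..<card F} F"
    using p N by (intro bij_betw_nth) auto
  ultimately have "bij_betw (window n (map hd p)) {..<card F} F"
    using N by (subst bij_betw_cong[of _ _ "(!) p"]) auto
  moreover have "set (map hd p) \<subseteq> {1..k}"
  proof -
    have "hd w \<in> {1..k}" if "w \<in> F" for w
      using sub[OF that] hd_in_set[OF nonempty[OF that]] by blast
    then show ?thesis using p(2) by auto
  qed
  ultimately have "is_ucycle n k F (map hd p)"
    unfolding is_ucycle_def using fin ne len sub N by (simp add: subset_iff)
  then show ?thesis ..
qed

section \<open>Words with non-decreasing letter counts\<close>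

definition sorted_count_words :: "nat \<Rightarrow> nat \<Rightarrow> nat list set" where
  "sorted_count_words n k =
     {w. length w = n \<and> set w = {1..k} \<and> mono_on {1..k} (count_list w)}"

lemma string_of_fun_image:
  "string_of_fun n ` {f \<in> onto_functions n k. mono_on {1..k} (preimage_card n f)}
     = sorted_count_words n k"
proof -
  have nth: "string_of_fun n f ! i = f (Suc i)" if "i < n" for f i
    using that by (simp add: string_of_fun_def del: upt_Suc)
  have cnt: "count_list (string_of_fun n f) = preimage_card n f" for f
  proof
    fix i
    have "count_list (string_of_fun n f) i = length (filter (\<lambda>j. f j = i) [1..<Suc n])"
      unfolding count_list_eq_length_filter string_of_fun_def filter_map length_map o_def
      by (simp only: eq_commute[of i])
    also have "\<dots> = card (set (filter (\<lambda>j. f j = i) [1..<Suc n]))"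
      by (rule distinct_card[symmetric]) simp
    also have "set (filter (\<lambda>j. f j = i) [1..<Suc n]) = {j \<in> {1..n}. f j = i}"
      by auto
    finally show "count_list (string_of_fun n f) i = preimage_card n f i"
      by (simp add: preimage_card_def)
  qed
  have set: "set (string_of_fun n f) = f ` {1..n}" for f
    by (simp add: string_of_fun_def atLeastLessThanSuc_atLeastAtMost del: upt_Suc)
  show ?thesis
  proof (intro equalityI subsetI)
    fix w
    assume "w \<in> string_of_fun n `
      {f \<in> onto_functions n k. mono_on {1..k} (preimage_card n f)}"
    then show "w \<in> sorted_count_words n k"
      using set cnt by (auto simp: sorted_count_words_def onto_functions_def string_of_fun_def
          simp del: upt_Suc)
  next
    fix w assume w: "w \<in> sorted_count_words n k"
    define f where "f = (\<lambda>i\<in>{1..n}. w ! (i - 1))"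
    have f: "string_of_fun n f = w"
      using w nth by (intro nth_equalityI)
        (auto simp: f_def sorted_count_words_def string_of_fun_def simp del: upt_Suc)
    have im: "f ` {1..n} = {1..k}"
      using set[of f] w unfolding f by (simp add: sorted_count_words_def)
    then have "f \<in> onto_functions n k"
      unfolding onto_functions_def by (auto simp: f_def)
    moreover have "mono_on {1..k} (preimage_card n f)"
      using w cnt[of f] f by (simp add: sorted_count_words_def)
    ultimately show "w \<in> string_of_fun n `
        {f \<in> onto_functions n k. mono_on {1..k} (preimage_card n f)}"
      using f by blast
  qed
qed

lemma count_list_update:
  assumes "p < length w" "y \<noteq> w ! p"
  shows "count_list (w[p := y]) =
    (count_list w)(w ! p := count_list w (w ! p) - 1, y := count_list w y + 1)"
proof
  fix i
  have "count (mset (w[p := y])) i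
      = ((count (mset w))(w ! p := count (mset w) (w ! p) - 1, y := count (mset w) y + 1)) i"
    using assms by (auto simp: mset_update)
  then show "count_list (w[p := y]) i =
    ((count_list w)(w ! p := count_list w (w ! p) - 1, y := count_list w y + 1)) i"
    by (simp add: count_mset)
qed

text \<open>Only the letter \<open>x\<close> loses an occurrence, so \<open>pos\<close> is what
  keeps the new word onto.\<close>

lemma letter_change_sorted_count_words:
  assumes w: "w \<in> sorted_count_words n k" and p: "p < n" "w ! p = x"
    and y: "y \<in> {1..k}" "x \<noteq> y"
    and c': "c' = (count_list w)(x := count_list w x - 1, y := count_list w y + 1)"
    and mono: "mono_on {1..k} c'" and pos: "c' x \<ge> 1"
  shows "letter_change (sorted_count_words n k) w (w[p := y])"
proof -
  have len: "length w = n" and set: "set w = {1..k}"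
    using w by (auto simp: sorted_count_words_def)
  have c: "count_list (w[p := y]) = c'"
    using count_list_update[of p w y] p y c' len by auto
  have "i \<in> set (w[p := y])" if "i \<in> {1..k}" for i
  proof -
    have "count_list w i \<noteq> 0" using that set by (simp add: count_list_0_iff)
    then have "count_list (w[p := y]) i \<noteq> 0" using pos unfolding c by (auto simp: c')
    then show ?thesis by (simp add: count_list_0_iff)
  qed
  moreover have "set (w[p := y]) \<subseteq> {1..k}"
    using set_update_subset_insert[of w p y] set y by auto
  ultimately have "w[p := y] \<in> sorted_count_words n k"
    using c mono len by (auto simp: sorted_count_words_def)
  then show ?thesis using w p len by (auto simp: letter_change_def)
qed

text \<open>Greedy descent: turn an occurrence of the smallest letter in excess of its target into
  the largest letter short of its target. The measure is the total deficit.\<close>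

lemma letter_changes_to_counts:
  assumes t: "mono_on {1..k} t" "\<And>i. i \<in> {1..k} \<Longrightarrow> t i \<ge> 1" "(\<Sum>i\<in>{1..k}. t i) = n"
    and w: "w \<in> sorted_count_words n k"
  shows "\<exists>w'. w' \<in> sorted_count_words n k \<and> (\<forall>i\<in>{1..k}. count_list w' i = t i) \<and>
    (letter_change (sorted_count_words n k))\<^sup>*\<^sup>* w w'"
  using w
proof (induction "\<Sum>i\<in>{1..k}. t i - count_list w i" arbitrary: w rule: less_induct)
  case less
  define c where "c = count_list w"
  have len: "length w = n" and set: "set w = {1..k}" and mono: "mono_on {1..k} c"
    using less.prems by (auto simp: sorted_count_words_def c_def)
  have sum: "(\<Sum>i\<in>{1..k}. c i) = n"
    unfolding c_def using sum_count_set[of w "{1..k}"] set len by simp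
  show ?case
  proof (cases "\<forall>i\<in>{1..k}. c i = t i")
    case True
    then show ?thesis using less.prems by (auto simp: c_def)
  next
    case False
    let ?X = "{i \<in> {1..k}. c i > t i}" and ?Y = "{i \<in> {1..k}. c i < t i}"
    have "?X \<noteq> {}"
    proof
      assume "?X = {}"
      then have le: "\<And>i. i \<in> {1..k} \<Longrightarrow> c i \<le> t i" by (auto simp: not_less)
      then have "(\<Sum>i\<in>{1..k}. c i) < (\<Sum>i\<in>{1..k}. t i)"
        using False by (intro sum_strict_mono_ex1) (auto simp: order.strict_iff_order)
      then show False using sum t by simp
    qed
    moreover have "?Y \<noteq> {}"
    proof
      assume "?Y = {}"
      then have le: "\<And>i. i \<in> {1..k} \<Longrightarrow> t i \<le> c i" by (auto simp: not_less)
      then have "(\<Sum>i\<in>{1..k}. t i) < (\<Sum>i\<in>{1..k}. c i)"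
        using False by (intro sum_strict_mono_ex1) (force simp: order.strict_iff_order)+
      then show False using sum t by simp
    qed
    moreover define x y where "x = Min ?X" and "y = Max ?Y"
    moreover have "finite ?X" "finite ?Y" by simp_all
    ultimately have "x \<in> ?X" "y \<in> ?Y"
      using Min_in[of ?X] Max_in[of ?Y] by blast+
    then have x: "x \<in> {1..k}" "c x > t x" and y: "y \<in> {1..k}" "c y < t y" by auto
    have below: "c i \<le> t i" if "i \<in> {1..k}" "i < x" for i
    proof (rule ccontr)
      assume "\<not> c i \<le> t i"
      then have "i \<in> ?X" using that by simp
      then have "x \<le> i" unfolding x_def by (intro Min_le) simp_all
      then show False using that by simp
    qed
    have above: "t i \<le> c i" if "i \<in> {1..k}" "y < i" for i
    proof (rule ccontr)
      assume "\<not> t i \<le> c i"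
      then have "i \<in> ?Y" using that by simp
      then have "i \<le> y" unfolding y_def by (intro Max_ge) simp_all
      then show False using that by simp
    qed
    have xy: "x \<noteq> y" using x y by auto
    define c' where "c' = c(x := c x - 1, y := c y + 1)"
    \<comment> \<open>Only a lowered right end or a raised left end could break the order. For i <
      \<open>x\<close>, c i \<le> t i \<le> t x \<le> c x - 1; for j > \<open>y\<close>, c y + 1
      \<le> t y \<le> t j \<le> c j. If \<open>y\<close> < \<open>x\<close>, then c y + 1 \<le> t y
      \<le> t x \<le> c x - 1 covers both changes at once.\<close>
    have mono': "mono_on {1..k} c'"
    proof (rule mono_onI)
      fix i j assume ij: "i \<in> {1..k}" "j \<in> {1..k}" "i \<le> j"
      have cij: "c i \<le> c j" and tij: "t i \<le> t j"
        using mono_onD[OF mono ij] mono_onD[OF t(1) ij] by simp_all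
      show "c' i \<le> c' j"
      proof (cases "i = j")
        case False
        then show ?thesis
          using cij tij below[OF ij(1)] above[OF ij(2)] x y xy ij(3)
          by (auto simp: c'_def)
      qed simp
    qed
    have "x \<in> set w" using x set by simp
    then obtain p where p: "p < n" "w ! p = x" using len by (auto simp: in_set_conv_nth)
    have "c' x \<ge> 1" using x t(2)[of x] xy by (simp add: c'_def)
    then have step: "letter_change (sorted_count_words n k) w (w[p := y])"
      using letter_change_sorted_count_words[OF less.prems p y(1) xy _ mono']
      by (simp add: c'_def c_def)
    have cnt: "count_list (w[p := y]) = c'"
      using count_list_update[of p w y] p xy len by (auto simp: c'_def c_def)
    \<comment> \<open>Subtraction is truncated: the term of \<open>x\<close> is 0 before and after
      the change, as \<open>c x\<close> exceeds \<open>t x\<close>, while the term of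
      \<open>y\<close> drops by one.\<close>
    have "(\<Sum>i\<in>{1..k}. t i - c' i) < (\<Sum>i\<in>{1..k}. t i - c i)"
      using x y xy by (intro sum_strict_mono_ex1) (auto simp: c'_def intro!: bexI[of _ y])
    then obtain w' where w': "w' \<in> sorted_count_words n k" "\<forall>i\<in>{1..k}. count_list w' i = t i"
        "(letter_change (sorted_count_words n k))\<^sup>*\<^sup>* (w[p := y]) w'"
      using less.hyps[of "w[p := y]"] step unfolding cnt c_def letter_change_def by blast
    then show ?thesis using step by (meson converse_rtranclp_into_rtranclp)
  qed
qed

section \<open>The hub: words with letter counts 2, 3, ..., k, r\<close>

text \<open>To let every letter below \<open>k\<close> lose one occurrence, the counts must increase
  strictly below \<open>k\<close> and start at 2 or more; i + 1 is the least such choice. The letter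
  \<open>k\<close> takes the remainder, and the assumption \<open>room\<close> below makes it at
  least \<open>k\<close>.\<close>

definition hub_counts :: "nat \<Rightarrow> nat \<Rightarrow> nat \<Rightarrow> nat" where
  "hub_counts n k i = (if i < k then i + 1 else n - (\<Sum>j\<in>{1..<k}. j + 1))"

context
  fixes n k :: nat
  assumes k: "k \<ge> 1" and room: "(\<Sum>j\<in>{1..<k}. j + 1) + k \<le> n"
begin

lemma hub_counts_last: "hub_counts n k k \<ge> k"
  using room by (simp add: hub_counts_def)

lemma hub_counts_ge_1: "i \<in> {1..k} \<Longrightarrow> hub_counts n k i \<ge> 1"
  using hub_counts_last k by (cases "i = k") (auto simp: hub_counts_def)

lemma hub_counts_mono: "mono_on {1..k} (hub_counts n k)"
  using hub_counts_last by (intro mono_onI) (auto simp: hub_counts_def)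

lemma hub_counts_sum: "(\<Sum>i\<in>{1..k}. hub_counts n k i) = n"
proof -
  have "{1..k} = insert k {1..<k}" using k by auto
  moreover have "(\<Sum>i\<in>{1..<k}. hub_counts n k i) = (\<Sum>j\<in>{1..<k}. j + 1)"
    by (intro sum.cong) (auto simp: hub_counts_def)
  moreover have "hub_counts n k k = n - (\<Sum>j\<in>{1..<k}. j + 1)"
    by (simp add: hub_counts_def)
  ultimately show ?thesis using room by simp
qed

definition hub_words :: "nat list set" where
  "hub_words = {w \<in> sorted_count_words n k. \<forall>i\<in>{1..k}. count_list w i = hub_counts n k i}"

lemma hub_words_perm: "w \<in> hub_words \<Longrightarrow> mset w' = mset w \<Longrightarrow> w' \<in> hub_words"
proof -
  assume w: "w \<in> hub_words" and m: "mset w' = mset w"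
  have "count_list w' = count_list w" using m by (metis count_mset ext)
  then show ?thesis
    using w mset_eq_length[OF m] mset_eq_setD[OF m]
    by (auto simp: hub_words_def sorted_count_words_def)
qed

lemma hub_words_mset_eq:
  assumes "w \<in> hub_words" "w' \<in> hub_words"
  shows "mset w = mset w'"
proof (rule multiset_eqI)
  fix i
  show "count (mset w) i = count (mset w') i"
    using assms unfolding hub_words_def sorted_count_words_def
    by (cases "i \<in> {1..k}") (auto simp: count_mset count_list_0_iff)
qed

lemma hub_words_nonempty: "hub_words \<noteq> {}"
proof -
  obtain w where "mset w = (\<Sum>i\<in>{1..k}. replicate_mset (hub_counts n k i) i)"
    using ex_mset by blast
  then have cnt: "count_list w i = (if i \<in> {1..k} then hub_counts n k i else 0)" for i
    by (simp add: count_mset[symmetric] count_sum)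
  have set: "set w = {1..k}"
  proof -
    have "i \<in> set w \<longleftrightarrow> i \<in> {1..k}" for i
      using cnt[of i] hub_counts_ge_1[of i] count_list_0_iff[of w i] by (auto split: if_splits)
    then show ?thesis by blast
  qed
  have "length w = n"
    using sum_count_set[of w "{1..k}"] set hub_counts_sum by (simp add: cnt)
  moreover have "mono_on {1..k} (count_list w)"
    using hub_counts_mono by (simp add: cnt mono_on_def)
  ultimately have "w \<in> hub_words"
    using set cnt by (auto simp: hub_words_def sorted_count_words_def)
  then show ?thesis by blast
qed

text \<open>First \<open>k\<close> is written over the letter x at \<open>p\<close>, then x over the
  old \<open>k\<close> at \<open>q\<close>. In between, x has count x, which equals the count x of
  its predecessor if there is one, and \<open>k\<close> has one occurrence more, so the order
  survives.\<close>

lemma hub_words_swap_last: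
  assumes w: "w \<in> hub_words" and pq: "p < n" "q < n" and kq: "w ! q = k" "w ! p \<noteq> k"
  shows "(letter_change (sorted_count_words n k))\<^sup>*\<^sup>* w (w[p := w ! q, q := w ! p])"
proof -
  let ?x = "w ! p" and ?F = "sorted_count_words n k"
  define w1 w2 where "w1 = w[p := k]" and "w2 = w1[q := ?x]"
  have wF: "w \<in> ?F" and len: "length w = n" and set: "set w = {1..k}"
    and cnt: "\<And>i. i \<in> {1..k} \<Longrightarrow> count_list w i = hub_counts n k i"
    using w by (auto simp: hub_words_def sorted_count_words_def)
  have x: "?x \<in> {1..k}" "?x < k"
    using nth_mem[of p w] len pq set kq by (auto simp: le_neq_implies_less)
  have "letter_change ?F w w1"
    unfolding w1_def
  proof (rule letter_change_sorted_count_words[OF wF pq(1) refl _ kq(2) refl])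
    show "mono_on {1..k} ((count_list w)
        (?x := count_list w ?x - 1, k := count_list w k + 1))"
      using cnt x hub_counts_last
      by (intro mono_onI) (auto simp: hub_counts_def)
  qed (use k x cnt in \<open>auto simp: hub_counts_def\<close>)
  \<comment> \<open>The second change needs no inspection of counts: its result is a rearrangement
    of \<open>w\<close>.\<close>
  moreover have "mset w2 = mset w"
    using mset_swap[of q w p] len pq kq by (simp add: w2_def w1_def)
  then have "w2 \<in> hub_words" using hub_words_perm w by blast
  ultimately have "letter_change ?F w w1" "letter_change ?F w1 w2"
    using len pq by (auto simp: letter_change_def hub_words_def w1_def w2_def)
  then show ?thesis using kq by (simp add: w1_def w2_def)
qed

text \<open>Two distinct letters below \<open>k\<close> are not traded directly. A position holding
  \<open>k\<close> serves as a free slot, and three swaps through it compose to the wanted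
  one.\<close>

lemma hub_words_swap:
  assumes w: "w \<in> hub_words" and pq: "p < n" "q < n"
  shows "(letter_change (sorted_count_words n k))\<^sup>*\<^sup>* w (w[p := w ! q, q := w ! p])"
proof -
  let ?R = "(letter_change (sorted_count_words n k))\<^sup>*\<^sup>*"
  have len: "length w = n" and set: "set w = {1..k}"
    using w by (auto simp: hub_words_def sorted_count_words_def)
  consider "w ! p = w ! q" | "w ! p \<noteq> k" "w ! q = k" | "w ! p = k" "w ! q \<noteq> k"
    | "w ! p \<noteq> k" "w ! q \<noteq> k" "p \<noteq> q"
    by metis
  then show ?thesis
  proof cases
    case 1
    then show ?thesis by (metis list_update_id rtranclp.rtrancl_refl)
  next
    case 2
    then show ?thesis using hub_words_swap_last w pq by blast
  next
    case 3
    then have "p \<noteq> q" by auto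
    then show ?thesis
      using hub_words_swap_last[of w q p] w pq 3 by (simp add: list_update_swap)
  next
    case 4
    have "k \<in> set w" using set k by simp
    then obtain r where r: "r < n" "w ! r = k" using len by (auto simp: in_set_conv_nth)
    have d: "r \<noteq> p" "r \<noteq> q" using r 4 by auto
    \<comment> \<open>\<open>(x, y, k) \<rightarrow> (k, y, x) \<rightarrow> (y, k, x) \<rightarrow> (y, x, k)\<close> on the positions \<open>p\<close>, \<open>q\<close>, \<open>r\<close>\<close>
    define swap where "swap i j u = u[i := u ! j, j := u ! i]" for i j and u :: "nat list"
    define u where "u = swap p r w"
    have hub: "swap i j u \<in> hub_words" if "u \<in> hub_words" "i < n" "j < n" for i j u
    proof (rule hub_words_perm[OF that(1)])
      have "length u = n" using that(1) by (auto simp: hub_words_def sorted_count_words_def)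
      then show "mset (swap i j u) = mset u"
        using that mset_swap[of j u i] by (simp add: swap_def)
    qed
    note s = hub_words_swap_last[folded swap_def]
    have "?R w u" unfolding u_def using s[OF w pq(1) r(1) r(2) 4(1)] .
    moreover have "u \<in> hub_words" unfolding u_def using hub w pq r by blast
    moreover have u: "u ! p = k" "u ! r = w ! p" "u ! q = w ! q" "length u = n"
      using d 4 len pq r by (auto simp: u_def swap_def nth_list_update)
    ultimately have "?R w (swap q p u)" "swap q p u \<in> hub_words"
      using s[of u q p] hub[of u q p] pq 4 by (auto intro: rtranclp_trans)
    moreover have "swap q p u ! r \<noteq> k" "swap q p u ! q = k"
      using d 4 u pq by (auto simp: swap_def nth_list_update)
    ultimately have "?R w (swap r q (swap q p u))"
      using s[of "swap q p u" r q] pq r by (auto intro: rtranclp_trans)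
    also have "swap r q (swap q p u) = w[p := w ! q, q := w ! p]"
      using d 4 len pq r by (intro nth_equalityI) (auto simp: u_def swap_def nth_list_update)
    finally show ?thesis .
  qed
qed

text \<open>Hub words are rearrangements of each other, and a permutation of positions is a product
  of transpositions.\<close>

lemma hub_words_connected:
  assumes "w \<in> hub_words" "w' \<in> hub_words"
  shows "(letter_change (sorted_count_words n k))\<^sup>*\<^sup>* w w'"
proof -
  have len: "length w = n" using assms by (auto simp: hub_words_def sorted_count_words_def)
  obtain f where f: "f permutes {..<n}" "permute_list f w = w'"
    using mset_eq_permutation[OF hub_words_mset_eq[OF assms(2,1)]] len by metis
  have "finite {..<n}" by simp
  then have "(letter_change (sorted_count_words n k))\<^sup>*\<^sup>* w (permute_list f w)"
    using f(1)
  proof (induction rule: permutes_rev_induct)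
    case id
    then show ?case by simp
  next
    case (swap a b f)
    let ?u = "permute_list f w"
    have "?u \<in> hub_words"
      using hub_words_perm[OF assms(1)] swap len by simp
    then have "(letter_change (sorted_count_words n k))\<^sup>*\<^sup>* ?u (?u[a := ?u ! b, b := ?u ! a])"
      using hub_words_swap swap by simp
    \<comment> \<open>A transposition composed on the right acts after \<open>f\<close>, on
      positions of the word already permuted; hence the reverse form of the induction.\<close>
    moreover have "permute_list (f \<circ> Transposition.transpose a b) w = ?u[a := ?u ! b, b := ?u ! a]"
    proof -
      have tr: "Transposition.transpose a b permutes {..<length w}"
        using swap len by (auto intro: permutes_swap_id)
      show ?thesis
        using swap len
        by (intro nth_equalityI)
          (auto simp: permute_list_compose[OF tr] permute_list_nth tr
            nth_list_update Transposition.transpose_def)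
    qed
    ultimately show ?case using swap by (metis rtranclp_trans)
  qed
  then show ?thesis using f by simp
qed

text \<open>Both words descend to hub words; the second path is reversed by symmetry of letter
  changes.\<close>

lemma sorted_count_words_connected:
  assumes "w \<in> sorted_count_words n k" "w' \<in> sorted_count_words n k"
  shows "(letter_change (sorted_count_words n k))\<^sup>*\<^sup>* w w'"
proof -
  have "\<exists>u \<in> hub_words. (letter_change (sorted_count_words n k))\<^sup>*\<^sup>* v u"
    if "v \<in> sorted_count_words n k" for v
    using letter_changes_to_counts[OF hub_counts_mono hub_counts_ge_1 hub_counts_sum that]
    by (auto simp: hub_words_def)
  then show ?thesis
    using assms hub_words_connected letter_changes_sym by (meson rtranclp_trans)
qed

lemma sorted_count_words_ucycle: "\<exists>a. is_ucycle n k (sorted_count_words n k) a"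
proof (rule ucycle_if_letter_changes_connected)
  have "sorted_count_words n k \<subseteq> {w. set w \<subseteq> {1..k} \<and> length w = n}"
    by (auto simp: sorted_count_words_def)
  then show "finite (sorted_count_words n k)"
    using finite_lists_length_eq[of "{1..k}" n] finite_subset by blast
  show "sorted_count_words n k \<noteq> {}"
    using hub_words_nonempty by (auto simp: hub_words_def)
  show "n > 0" using k room by simp
  show "w' \<in> sorted_count_words n k"
    if "w \<in> sorted_count_words n k" "mset w' = mset w" for w w'
  proof -
    have "count_list w' = count_list w" using that(2) by (metis count_mset ext)
    then show ?thesis
      using that mset_eq_length[OF that(2)] mset_eq_setD[OF that(2)]
      by (auto simp: sorted_count_words_def)
  qed
  show "length w = n" "set w \<subseteq> {1..k}" if "w \<in> sorted_count_words n k" for w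
    using that by (auto simp: sorted_count_words_def)
qed (rule sorted_count_words_connected)

end

theorem theorem2:
  fixes k n :: nat
  assumes "k \<ge> 1" and "n \<ge> 1"
    and "real n \<ge> (real k + 4) * (real k - 1) / 2 + 1"
  shows "\<exists>a. is_ucycle n k
    (string_of_fun n ` {f \<in> onto_functions n k. mono_on {1..k} (preimage_card n f)}) a"
proof -
  \<comment> \<open>The hub needs (k - 1)(k + 2)/2 + k letters, which equals (k + 4)(k - 1)/2 + 1,
    the assumed lower bound on \<open>n\<close>.\<close>
  have "2 * (\<Sum>j\<in>{1..<k}. real (j + 1)) = (real k - 1) * (real k + 2)"
    using assms(1) by (induction k rule: dec_induct) (auto simp: algebra_simps)
  then have "real ((\<Sum>j\<in>{1..<k}. j + 1) + k) \<le> real n"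
    using assms(3) by (simp add: field_simps)
  then have "(\<Sum>j\<in>{1..<k}. j + 1) + k \<le> n" by (simp only: of_nat_le_iff)
  then show ?thesis
    unfolding string_of_fun_image by (rule sorted_count_words_ucycle[OF assms(1)])
qed

end
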